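(* Let $H$ be a graph with $v$ vertices and $e\geq 1$ edges, and let $k\geq 2$. Then $$f_k(n,H)=O\left(\max\left\{n,\ n^{\frac{kv-2}{(k-1)e}}\right\}\right).$$
   Context: All colourings are edge-colourings of the complete graph $K_n$; a colouring is proper if any two edges sharing a vertex receive different colours. Two copies of a graph $H$ in an edge-coloured $K_n$ are colour isomorphic if there is a graph isomorphism between them mapping each edge to an edge of the same colour. A $k$-repeat of $H$ is a collection of $k$ pairwise vertex-disjoint, pairwise colour-isomorphic copies of $H$. For integers $k,n\geq 2$ and a graph $H$, $f_k(n,H)$ is the smallest integer $C$ such that there is a proper edge-colouring of $K_n$ with $C$ colours containing no $k$-repeat of $H$. Asymptotic notation is with respect to $n\to\infty$ with $H,k$ fixed. *)

theory Defs
  imports "HOL-Library.Ramsey" "HOL-Library.Disjoint_Sets" "HOL-Library.Landau_Symbols"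
    "HOL-Analysis.Analysis"
begin

text \<open>A finite simple graph is a pair of a vertex set and an edge set, where the edges are
  two-element sets of vertices.\<close>

type_synonym 'a ugraph = "'a set \<times> 'a set set"

abbreviation verts :: "'a ugraph \<Rightarrow> 'a set" where "verts \<equiv> fst"

abbreviation edges :: "'a ugraph \<Rightarrow> 'a set set" where "edges \<equiv> snd"

definition simple_graph :: "'a ugraph \<Rightarrow> bool" where
  "simple_graph G \<longleftrightarrow> finite (verts G) \<and> edges G \<subseteq> [verts G]\<^bsup>2\<^esup>"

definition complete_graph :: "nat \<Rightarrow> nat ugraph" where
  "complete_graph n = ({..<n}, [{..<n}]\<^bsup>2\<^esup>)"

definition subgraph_of :: "'a ugraph \<Rightarrow> 'a ugraph \<Rightarrow> bool" where
  "subgraph_of G K \<longleftrightarrow> simple_graph G \<and> verts G \<subseteq> verts K \<and> edges G \<subseteq> edges K"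

definition graph_iso :: "('a \<Rightarrow> 'b) \<Rightarrow> 'a ugraph \<Rightarrow> 'b ugraph \<Rightarrow> bool" where
  "graph_iso \<phi> G G' \<longleftrightarrow> bij_betw \<phi> (verts G) (verts G') \<and>
     (\<forall>x\<in>verts G. \<forall>y\<in>verts G. {x, y} \<in> edges G \<longleftrightarrow> {\<phi> x, \<phi> y} \<in> edges G')"

definition copy_in :: "'a ugraph \<Rightarrow> 'b ugraph \<Rightarrow> 'b ugraph \<Rightarrow> bool" where
  "copy_in H K G \<longleftrightarrow> subgraph_of G K \<and> (\<exists>\<phi>. graph_iso \<phi> H G)"

definition proper_colouring :: "'b ugraph \<Rightarrow> ('b set \<Rightarrow> 'c) \<Rightarrow> bool" where
  "proper_colouring K c \<longleftrightarrow>
     (\<forall>d\<in>edges K. \<forall>e\<in>edges K. d \<noteq> e \<and> d \<inter> e \<noteq> {} \<longrightarrow> c d \<noteq> c e)"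

definition colour_isomorphic :: "('b set \<Rightarrow> 'c) \<Rightarrow> 'b ugraph \<Rightarrow> 'b ugraph \<Rightarrow> bool" where
  "colour_isomorphic c G G' \<longleftrightarrow> (\<exists>\<phi>. graph_iso \<phi> G G' \<and> (\<forall>e\<in>edges G. c (\<phi> ` e) = c e))"

definition is_repeat ::
    "nat \<Rightarrow> 'a ugraph \<Rightarrow> 'b ugraph \<Rightarrow> ('b set \<Rightarrow> 'c) \<Rightarrow> 'b ugraph set \<Rightarrow> bool" where
  "is_repeat k H K c R \<longleftrightarrow> finite R \<and> card R = k \<and> (\<forall>G\<in>R. copy_in H K G) \<and>
     pairwise (\<lambda>G G'. disjnt (verts G) (verts G') \<and> colour_isomorphic c G G') R"

definition repeat_free_colouring ::
    "nat \<Rightarrow> nat \<Rightarrow> 'a ugraph \<Rightarrow> nat \<Rightarrow> (nat set \<Rightarrow> nat) \<Rightarrow> bool" where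
  "repeat_free_colouring k n H C c \<longleftrightarrow>
     c ` edges (complete_graph n) \<subseteq> {..<C} \<and>
     proper_colouring (complete_graph n) c \<and>
     (\<nexists>R. is_repeat k H (complete_graph n) c R)"

definition repeat_num :: "nat \<Rightarrow> nat \<Rightarrow> 'a ugraph \<Rightarrow> nat" where
  "repeat_num k n H = (LEAST C. \<exists>c. repeat_free_colouring k n H C c)"

text \<open>The minimum is taken over a nonempty set: colouring all edges differently leaves no
  repeat of a graph with at least one edge.\<close>

lemma repeat_num_attained:
  assumes "simple_graph H" "edges H \<noteq> {}" "k \<ge> 2"
  shows "\<exists>c. repeat_free_colouring k n H (repeat_num k n H) c"
proof -
  let ?E = "edges (complete_graph n)"
  have "finite ?E"
    by (simp add: complete_graph_def finite_imp_finite_nsets)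
  then obtain c :: "nat set \<Rightarrow> nat" and C where c: "inj_on c ?E" "c ` ?E = {i. i < C}"
    using finite_imp_inj_to_nat_seg by metis
  have "\<not> is_repeat k H (complete_graph n) c R" for R
  proof
    assume R: "is_repeat k H (complete_graph n) c R"
    then have "card R \<ge> 2" "finite R"
      using assms by (auto simp: is_repeat_def)
    then obtain G G' where G: "G \<in> R" "G' \<in> R" "G \<noteq> G'"
      by (metis card_le_Suc0_iff_eq not_less_eq_eq numeral_2_eq_2)
    from R G have disj: "disjnt (verts G) (verts G')" and "colour_isomorphic c G G'"
      and sub: "subgraph_of G (complete_graph n)" "subgraph_of G' (complete_graph n)"
      and "copy_in H (complete_graph n) G"
      by (auto simp: is_repeat_def pairwise_def copy_in_def)
    then obtain \<phi> \<psi> where \<phi>: "graph_iso \<phi> G G'" "\<forall>e\<in>edges G. c (\<phi> ` e) = c e"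
      and \<psi>: "graph_iso \<psi> H G"
      by (auto simp: colour_isomorphic_def copy_in_def)
    obtain d where d: "d \<in> edges H" using assms by blast
    then have "d \<in> [verts H]\<^bsup>2\<^esup>" using assms by (auto simp: simple_graph_def)
    then obtain x y where xy: "d = {x, y}" "x \<in> verts H" "y \<in> verts H"
      by (auto simp: nsets_def card_2_iff)
    then have e: "{\<psi> x, \<psi> y} \<in> edges G" and v: "\<psi> x \<in> verts G" "\<psi> y \<in> verts G"
      using \<psi> d by (auto simp: graph_iso_def bij_betw_def)
    then have e': "{\<phi> (\<psi> x), \<phi> (\<psi> y)} \<in> edges G'" and v': "\<phi> (\<psi> x) \<in> verts G'"
      using \<phi> by (auto simp: graph_iso_def bij_betw_def)
    have "c {\<phi> (\<psi> x), \<phi> (\<psi> y)} = c {\<psi> x, \<psi> y}"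
      using \<phi>(2) e by fastforce
    then have "{\<phi> (\<psi> x), \<phi> (\<psi> y)} = {\<psi> x, \<psi> y}"
      using c(1) e e' sub by (meson inj_onD subgraph_of_def subsetD)
    then show False
      using v v' disj by (auto simp: disjnt_def doubleton_eq_iff)
  qed
  moreover have "proper_colouring (complete_graph n) c"
    using c(1) by (auto simp: proper_colouring_def inj_on_def)
  ultimately have "repeat_free_colouring k n H C c"
    using c(2) by (auto simp: repeat_free_colouring_def)
  then have "\<exists>C c. repeat_free_colouring k n H C c" by blast
  then show ?thesis unfolding repeat_num_def by (rule LeastI_ex)
qed

end

theory Submission
  imports Defs
begin

text \<open>Rosenfeld's counting method replaces the local lemma. Colour the edges of \<open>K\<^sub>n\<close> one at a
  time and let \<open>N(F)\<close> be the number of good \<open>C\<close>-colourings of an edge set \<open>F\<close>. One shows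
  \<open>N(F \<union> {e}) \<ge> (C/2) N(F)\<close> by induction on \<open>F\<close>: an extension to \<open>e\<close> fails either because \<open>e\<close> repeats
  the colour of one of at most \<open>2n\<close> adjacent edges, or because \<open>e\<close> completes one of
  \<open>O(n\<^bsup>kv-2\<^esup>)\<close> repeats. In the latter case the colours on one copy avoiding \<open>e\<close> determine those on
  the \<open>(k-1)e(H)\<close> edges of the other copies, so by the induction hypothesis each such repeat spoils
  at most \<open>N(F) (2/C)\<^bsup>(k-1)e(H)-1\<^esup>\<close> extensions.\<close>

section \<open>Counting good colourings\<close>

text \<open>Extensionality leaves one representative per colouring of \<open>F\<close>, so the set
  is finite and its cardinality really counts colourings.\<close>

definition good_colourings :: "('e set \<Rightarrow> ('e \<Rightarrow> nat) \<Rightarrow> bool) \<Rightarrow> nat \<Rightarrow> 'e set \<Rightarrow> ('e \<Rightarrow> nat) set" where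
  "good_colourings ok C F = {c \<in> F \<rightarrow>\<^sub>E {..<C}. ok F c}"

lemma finite_good_colourings: "finite F \<Longrightarrow> finite (good_colourings ok C F)"
  by (simp add: good_colourings_def finite_PiE)

text \<open>\<open>I e\<close> indexes the obstructions through \<open>e\<close>; the colours outside \<open>T i\<close> determine those on
  \<open>T i\<close> whenever obstruction \<open>i\<close> is present.\<close>

locale obstructed_colouring =
  fixes E :: "'e set" and ok :: "'e set \<Rightarrow> ('e \<Rightarrow> nat) \<Rightarrow> bool" and C :: nat
    and I :: "'e \<Rightarrow> 'i set" and T :: "'i \<Rightarrow> 'e set" and bad :: "'i \<Rightarrow> ('e \<Rightarrow> nat) \<Rightarrow> bool"
    and \<beta> :: real
  assumes finite_E: "finite E"
    and finite_I: "\<And>e. e \<in> E \<Longrightarrow> finite (I e)"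
    and ok_empty: "\<And>c. ok {} c"
    and ok_mono: "\<And>F F' c c'. ok F c \<Longrightarrow> F' \<subseteq> F \<Longrightarrow> (\<And>x. x \<in> F' \<Longrightarrow> c x = c' x) \<Longrightarrow> ok F' c'"
    and obstruction: "\<And>F e c. F \<subseteq> E \<Longrightarrow> e \<in> E - F \<Longrightarrow> ok F c \<Longrightarrow> \<not> ok (insert e F) c \<Longrightarrow>
      \<exists>i\<in>I e. T i \<subseteq> insert e F \<and> bad i c"
    and mem_T: "\<And>e i. e \<in> E \<Longrightarrow> i \<in> I e \<Longrightarrow> e \<in> T i"
    and determined: "\<And>e i c c'. e \<in> E \<Longrightarrow> i \<in> I e \<Longrightarrow> bad i c \<Longrightarrow> bad i c' \<Longrightarrow>
      (\<And>x. x \<notin> T i \<Longrightarrow> c x = c' x) \<Longrightarrow> c = c'"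
    and pos: "\<beta> > 0"
    and weight: "\<And>e. e \<in> E \<Longrightarrow> \<beta> + (\<Sum>i\<in>I e. (1 / \<beta>) ^ (card (T i) - 1)) \<le> real C"
begin

abbreviation N :: "'e set \<Rightarrow> real" where
  "N F \<equiv> real (card (good_colourings ok C F))"

lemma good_colourings_restrict:
  assumes "c \<in> F \<rightarrow>\<^sub>E {..<C}" "ok F' c" "F' \<subseteq> F"
  shows "restrict c F' \<in> good_colourings ok C F'"
  using assms ok_mono[of F' c F' "restrict c F'"]
  by (auto simp: good_colourings_def PiE_iff)

text \<open>Restriction to \<open>F - T i\<close> loses nothing: it fixes the colouring off
  \<open>T i\<close>, and by \<open>determined\<close> an obstructed colouring can be recovered from
  there. As \<open>e\<close> is in \<open>T i\<close>, the restriction no longer involves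
  \<open>e\<close>.\<close>

lemma card_bad_extensions:
  assumes F: "F \<subseteq> E" and e: "e \<in> E - F" and i: "i \<in> I e" and T: "T i \<subseteq> insert e F"
  shows "card {c \<in> insert e F \<rightarrow>\<^sub>E {..<C}. ok F c \<and> bad i c} \<le> card (good_colourings ok C (F - T i))"
proof (rule card_inj_on_le)
  let ?B = "{c \<in> insert e F \<rightarrow>\<^sub>E {..<C}. ok F c \<and> bad i c}"
  show "inj_on (\<lambda>c. restrict c (F - T i)) ?B"
  proof (rule inj_onI)
    fix c c' assume c: "c \<in> ?B" "c' \<in> ?B" and eq: "restrict c (F - T i) = restrict c' (F - T i)"
    \<comment> \<open>A point off \<open>T i\<close> is not \<open>e\<close>. It lies in
      \<open>F\<close>, where the restrictions agree, or outside \<open>insert e F\<close>, where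
      both functions take the default value.\<close>
    have "c x = c' x" if "x \<notin> T i" for x
    proof (cases "x \<in> F")
      case True
      then show ?thesis using fun_cong[OF eq, of x] that by auto
    next
      case False
      then have "x \<notin> insert e F" using that mem_T[of e i] i e by auto
      moreover have "c \<in> extensional (insert e F)" "c' \<in> extensional (insert e F)"
        using c by (auto simp: PiE_def)
      ultimately show ?thesis by (metis extensional_arb)
    qed
    then show "c = c'" using determined[of e i c c'] c e i by auto
  qed
  show "(\<lambda>c. restrict c (F - T i)) ` ?B \<subseteq> good_colourings ok C (F - T i)"
  proof clarify
    fix c assume c: "c \<in> insert e F \<rightarrow>\<^sub>E {..<C}" "ok F c"
    then have "ok (F - T i) c" using ok_mono[of F c] by blast
    with c(1) show "restrict c (F - T i) \<in> good_colourings ok C (F - T i)"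
      by (rule good_colourings_restrict) auto
  qed
  show "finite (good_colourings ok C (F - T i))"
    using finite_subset[OF F finite_E] by (simp add: finite_good_colourings)
qed

text \<open>By \<open>ok_mono\<close> the condition \<open>ok F c\<close> does not look at the
  colour of \<open>e\<close>, so that colour is a free choice among \<open>C\<close>.\<close>

lemma card_all_extensions:
  assumes F: "F \<subseteq> E" and e: "e \<in> E - F"
  shows "card {c \<in> insert e F \<rightarrow>\<^sub>E {..<C}. ok F c} = C * card (good_colourings ok C F)"
proof -
  let ?h = "\<lambda>(a, c). c(e := a)"
  have inj: "inj_on ?h ({..<C} \<times> good_colourings ok C F)"
    by (rule inj_on_subset[OF inj_combinator[of e F "\<lambda>_. {..<C}"]])
      (use e in \<open>auto simp: good_colourings_def\<close>)
  have "{c \<in> insert e F \<rightarrow>\<^sub>E {..<C}. ok F c} = ?h ` ({..<C} \<times> good_colourings ok C F)" (is "?L = ?R")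
  proof
    show "?L \<subseteq> ?R"
    proof
      fix c assume c: "c \<in> ?L"
      then have "c = ?h (c e, restrict c F)"
        by (auto simp: fun_eq_iff PiE_iff extensional_def)
      moreover have "restrict c F \<in> good_colourings ok C F"
        using c ok_mono[of F c F "restrict c F"] by (auto simp: good_colourings_def PiE_iff)
      moreover have "c e < C" using c by auto
      ultimately show "c \<in> ?R" by blast
    qed
    show "?R \<subseteq> ?L"
    proof clarify
      fix a c assume a: "a < C" and c: "c \<in> good_colourings ok C F"
      have "ok F c" using c by (simp add: good_colourings_def)
      then have "ok F (c(e := a))" by (rule ok_mono) (use e in auto)
      then show "c(e := a) \<in> insert e F \<rightarrow>\<^sub>E {..<C} \<and> ok F (c(e := a))"
        using a c by (auto simp: good_colourings_def PiE_iff extensional_def)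
    qed
  qed
  then show ?thesis using card_image[OF inj] by (simp add: card_cartesian_product)
qed

text \<open>Telescoping: putting the elements of \<open>D\<close> back one at a time gains a factor
  \<beta> each. The step is assumed only for proper subsets of \<open>F\<close>, so that the lemma
  can be applied inside the induction that proves the step in general.\<close>

lemma N_diff:
  assumes step: "\<And>F' e'. F' \<subset> F \<Longrightarrow> e' \<in> F - F' \<Longrightarrow> \<beta> * N F' \<le> N (insert e' F')"
    and "finite F" "D \<subseteq> F"
  shows "\<beta> ^ card D * N (F - D) \<le> N F"
proof -
  have "finite D" using assms finite_subset by blast
  then show ?thesis using \<open>D \<subseteq> F\<close>
  proof (induction D)
    case (insert d D)
    have "\<beta> * N (F - insert d D) \<le> N (insert d (F - insert d D))"
      by (rule step) (use insert.prems in auto)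
    also have "insert d (F - insert d D) = F - D" using insert by auto
    finally have "\<beta> ^ card D * (\<beta> * N (F - insert d D)) \<le> \<beta> ^ card D * N (F - D)"
      using pos by (intro mult_left_mono) auto
    also have "\<dots> \<le> N F" using insert by auto
    finally show ?case using insert.hyps by (simp add: mult_ac)
  qed simp
qed

text \<open>Of the \<open>C * N F\<close> extensions, obstruction \<open>i\<close> spoils at most
  \<open>N (F - T i)\<close>, which the induction hypothesis bounds by \<open>N F\<close> times a
  power of 1/\<beta>. By \<open>weight\<close> the total loss is at most
  \<open>(C - \<beta>) * N F\<close>.\<close>

lemma N_insert:
  assumes "F \<subseteq> E" "e \<in> E - F"
  shows "\<beta> * N F \<le> N (insert e F)"
proof -
  have "finite F" using assms finite_E finite_subset by blast
  then show ?thesis using assms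
  proof (induction F arbitrary: e rule: finite_psubset_induct)
    case (psubset F)
    let ?X = "{c \<in> insert e F \<rightarrow>\<^sub>E {..<C}. ok F c}"
    let ?J = "{i \<in> I e. T i \<subseteq> insert e F}"
    let ?B = "\<lambda>i. {c \<in> insert e F \<rightarrow>\<^sub>E {..<C}. ok F c \<and> bad i c}"
    have finJ: "finite ?J" using finite_I psubset.prems by auto
    have bad_le: "real (card (?B i)) \<le> N F * (1 / \<beta>) ^ (card (T i) - 1)" if i: "i \<in> ?J" for i
    proof -
      have eT: "e \<in> T i" using mem_T i psubset.prems by auto
      have finT: "finite (T i)" using i psubset.hyps finite_subset by auto
      \<comment> \<open>Since \<open>e\<close> lies in \<open>T i\<close> but not in
        \<open>F\<close>, only \<open>card (T i) - 1\<close> elements are taken out of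
        \<open>F\<close>; this is the exponent in \<open>weight\<close>.\<close>
      have "\<beta> ^ card (T i - {e}) * N (F - (T i - {e})) \<le> N F"
      proof (rule N_diff)
        fix F' e' assume "F' \<subset> F" "e' \<in> F - F'"
        then show "\<beta> * N F' \<le> N (insert e' F')"
          using psubset.IH[of F' e'] psubset.prems by auto
      qed (use i psubset.hyps in auto)
      then have "N (F - (T i - {e})) \<le> N F * (1 / \<beta>) ^ (card (T i) - 1)"
        using pos eT finT by (simp add: field_simps)
      moreover have "F - (T i - {e}) = F - T i" using psubset.prems by auto
      moreover have "real (card (?B i)) \<le> N (F - T i)"
        using card_bad_extensions[of F e i] i psubset.prems by simp
      ultimately show ?thesis by simp
    qed
    have "?X \<subseteq> good_colourings ok C (insert e F) \<union> (\<Union>i\<in>?J. ?B i)"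
    proof
      fix c assume c: "c \<in> ?X"
      show "c \<in> good_colourings ok C (insert e F) \<union> (\<Union>i\<in>?J. ?B i)"
      proof (cases "ok (insert e F) c")
        case True
        then show ?thesis using c by (auto simp: good_colourings_def)
      next
        case False
        then obtain i where "i \<in> I e" "T i \<subseteq> insert e F" "bad i c"
          using obstruction[of F e c] psubset.prems c by auto
        then show ?thesis using c by auto
      qed
    qed
    then have "card ?X \<le> card (good_colourings ok C (insert e F) \<union> (\<Union>i\<in>?J. ?B i))"
      using psubset.hyps finJ
      by (intro card_mono) (auto simp: finite_good_colourings finite_PiE)
    also have "\<dots> \<le> card (good_colourings ok C (insert e F)) + card (\<Union>i\<in>?J. ?B i)"
      by (rule card_Un_le)
    also have "card (\<Union>i\<in>?J. ?B i) \<le> (\<Sum>i\<in>?J. card (?B i))"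
      using finJ by (rule card_UN_le)
    finally have "C * card (good_colourings ok C F) \<le>
        card (good_colourings ok C (insert e F)) + (\<Sum>i\<in>?J. card (?B i))"
      using card_all_extensions psubset.prems by simp
    from of_nat_mono[OF this, where ?'a = real]
    have "real C * N F \<le> N (insert e F) + (\<Sum>i\<in>?J. real (card (?B i)))"
      by simp
    also have "(\<Sum>i\<in>?J. real (card (?B i))) \<le> (\<Sum>i\<in>?J. N F * (1 / \<beta>) ^ (card (T i) - 1))"
      by (intro sum_mono bad_le)
    also have "\<dots> \<le> (\<Sum>i\<in>I e. N F * (1 / \<beta>) ^ (card (T i) - 1))"
      using finite_I psubset.prems pos by (intro sum_mono2) auto
    also have "\<dots> = N F * (\<Sum>i\<in>I e. (1 / \<beta>) ^ (card (T i) - 1))"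
      by (simp add: sum_distrib_left)
    also have "\<dots> \<le> N F * (real C - \<beta>)"
      using weight[of e] psubset.prems by (intro mult_left_mono) auto
    finally show ?case by (simp add: algebra_simps)
  qed
qed

text \<open>Removing all of \<open>E\<close> in \<open>N_diff\<close> compares \<open>N E\<close>
  with the empty edge set, which has exactly one good colouring, so \<open>N E\<close> is
  positive.\<close>

theorem good_colouring_exists: "\<exists>c \<in> E \<rightarrow>\<^sub>E {..<C}. ok E c"
proof -
  have "\<beta> ^ card E * N (E - E) \<le> N E"
    by (rule N_diff) (use N_insert finite_E in auto)
  moreover have "good_colourings ok C {} = {\<lambda>_. undefined}"
    using ok_empty by (auto simp: good_colourings_def)
  moreover have "\<beta> ^ card E > 0" using pos by simp
  ultimately have "N E > 0" by simp
  then have "good_colourings ok C E \<noteq> {}" by auto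
  then show ?thesis by (auto simp: good_colourings_def)
qed

end

section \<open>Repeats as injections\<close>

text \<open>A \<open>k\<close>-repeat is encoded by one injection \<open>\<Phi>\<close> of \<open>{..<k} \<times> verts H\<close>, whose \<open>i\<close>-th layer embeds
  the \<open>i\<close>-th copy.\<close>

lemma is_repeat_injection:
  assumes H: "simple_graph H" and k: "k \<ge> 1" and R: "is_repeat k H K c R"
  obtains \<Phi> where "\<Phi> \<in> {..<k} \<times> verts H \<rightarrow>\<^sub>E verts K" "inj_on \<Phi> ({..<k} \<times> verts H)"
    "\<And>i d. i < k \<Longrightarrow> d \<in> edges H \<Longrightarrow> \<Phi> ` ({i} \<times> d) \<in> edges K"
    "\<And>i j d. i < k \<Longrightarrow> j < k \<Longrightarrow> d \<in> edges H \<Longrightarrow> c (\<Phi> ` ({i} \<times> d)) = c (\<Phi> ` ({j} \<times> d))"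
proof -
  have R': "finite R" "card R = k" "\<And>G. G \<in> R \<Longrightarrow> copy_in H K G"
    "pairwise (\<lambda>G G'. disjnt (verts G) (verts G') \<and> colour_isomorphic c G G') R"
    using R by (auto simp: is_repeat_def)
  obtain G where G: "bij_betw G {..<k} R"
    using ex_bij_betw_nat_finite[OF R'(1)] R'(2) by (metis atLeast0LessThan)
  have GR: "G i \<in> R" if "i < k" for i using G that by (auto simp: bij_betw_def)
  have G_disj: "disjnt (verts (G i)) (verts (G j))" if "i < k" "j < k" "i \<noteq> j" for i j
  proof -
    have "G i \<noteq> G j" using G that by (auto simp: bij_betw_def inj_on_def)
    then show ?thesis using R'(4) GR that by (auto simp: pairwise_def)
  qed
  have sub: "subgraph_of (G i) K" if "i < k" for i
    using R'(3)[OF GR[OF that]] by (simp add: copy_in_def)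
  obtain \<psi> where \<psi>: "graph_iso \<psi> H (G 0)"
    using R'(3)[OF GR[of 0]] k by (auto simp: copy_in_def)
  \<comment> \<open>All copies are reached from copy 0, so that one labelling \<open>\<psi>\<close>
    serves every layer and corresponding edges share a colour. For \<open>i = 0\<close> the identity
    is used, as \<open>pairwise\<close> is silent on a copy and itself.\<close>
  have "\<exists>\<phi>. graph_iso \<phi> (G 0) (G i) \<and> (\<forall>d\<in>edges (G 0). c (\<phi> ` d) = c d)" if "i < k" for i
  proof (cases "i = 0")
    case True
    then show ?thesis by (intro exI[of _ id]) (auto simp: graph_iso_def)
  next
    case False
    then have "G 0 \<noteq> G i" using G that k by (auto simp: bij_betw_def inj_on_def)
    then have "colour_isomorphic c (G 0) (G i)"
      using R'(4) GR[of 0] GR[OF that] k by (auto simp: pairwise_def)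
    then show ?thesis by (simp add: colour_isomorphic_def)
  qed
  then obtain \<phi> where \<phi>: "\<And>i. i < k \<Longrightarrow> graph_iso (\<phi> i) (G 0) (G i)"
    and col: "\<And>i d. i < k \<Longrightarrow> d \<in> edges (G 0) \<Longrightarrow> c (\<phi> i ` d) = c d"
    by metis
  let ?A = "{..<k} \<times> verts H"
  define \<Phi> where "\<Phi> = (\<lambda>(i, x) \<in> ?A. \<phi> i (\<psi> x))"
  have bij: "bij_betw (\<phi> i \<circ> \<psi>) (verts H) (verts (G i))" if "i < k" for i
    using \<psi> \<phi>[OF that] by (auto simp: graph_iso_def intro: bij_betw_trans)
  have image: "\<Phi> ` ({i} \<times> d) = \<phi> i ` \<psi> ` d" if "i < k" "d \<subseteq> verts H" for i d
    using that by (force simp: \<Phi>_def)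
  have sub_verts: "d \<subseteq> verts H" if "d \<in> edges H" for d
    using H that by (auto simp: simple_graph_def nsets_def)
  have \<psi>_edge: "\<psi> ` d \<in> edges (G 0)" if d: "d \<in> edges H" for d
  proof -
    obtain x y where "d = {x, y}" using H d by (auto simp: simple_graph_def nsets_def card_2_iff)
    then show ?thesis using \<psi> d sub_verts[OF d] by (auto simp: graph_iso_def)
  qed
  have \<phi>_edge: "\<phi> i ` d \<in> edges (G i)" if i: "i < k" and d: "d \<in> edges (G 0)" for i d
  proof -
    have "simple_graph (G 0)" using sub[of 0] i by (simp add: subgraph_of_def)
    then obtain x y where "d = {x, y}" "x \<in> verts (G 0)" "y \<in> verts (G 0)"
      using d by (auto simp: simple_graph_def nsets_def card_2_iff)
    then show ?thesis using \<phi>[OF i] d by (auto simp: graph_iso_def)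
  qed
  show thesis
  proof
    have "(\<phi> i \<circ> \<psi>) x \<in> verts K" if "i < k" "x \<in> verts H" for i x
      using bij_betwE[OF bij] that sub[of i] by (auto simp: subgraph_of_def)
    then show "\<Phi> \<in> ?A \<rightarrow>\<^sub>E verts K" by (auto simp: \<Phi>_def)
    show "inj_on \<Phi> ?A"
    proof (rule inj_onI, clarify)
      fix i x j y
      assume ij: "i < k" "j < k" and xy: "x \<in> verts H" "y \<in> verts H" and "\<Phi> (i, x) = \<Phi> (j, y)"
      then have eq: "(\<phi> i \<circ> \<psi>) x = (\<phi> j \<circ> \<psi>) y" by (simp add: \<Phi>_def)
      have "i = j"
        using G_disj[of i j] bij_betwE[OF bij] ij xy eq by (metis disjnt_iff)
      moreover have "inj_on (\<phi> i \<circ> \<psi>) (verts H)" using bij[OF ij(1)] by (rule bij_betw_imp_inj_on)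
      ultimately show "i = j \<and> x = y" using eq xy by (metis inj_onD)
    qed
    show "\<Phi> ` ({i} \<times> d) \<in> edges K" if "i < k" "d \<in> edges H" for i d
      using that image sub_verts \<phi>_edge[OF _ \<psi>_edge] sub[of i] by (auto simp: subgraph_of_def)
    show "c (\<Phi> ` ({i} \<times> d)) = c (\<Phi> ` ({j} \<times> d))" if "i < k" "j < k" "d \<in> edges H" for i j d
      using that image sub_verts col \<psi>_edge by simp
  qed
qed

section \<open>Counting maps onto a given edge, and adjacent edges\<close>

lemma card_PiE_two_fixed:
  assumes "finite A" "p \<in> A" "q \<in> A" "p \<noteq> q"
  shows "card {f \<in> A \<rightarrow>\<^sub>E B. f p = a \<and> f q = b} \<le> card B ^ (card A - 2)"
proof (cases "a \<in> B \<and> b \<in> B")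
  case True
  let ?D = "\<lambda>z. if z = p then {a} else if z = q then {b} else B"
  have "{f \<in> A \<rightarrow>\<^sub>E B. f p = a \<and> f q = b} = PiE A ?D"
    using assms True by (auto simp: PiE_iff extensional_def split: if_splits)
  also have "card \<dots> = (\<Prod>z\<in>A. card (?D z))" using assms(1) by (rule card_PiE)
  also have "\<dots> = (\<Prod>z\<in>A - {p, q}. card (?D z))"
    using assms(1) by (intro prod.mono_neutral_right) auto
  also have "\<dots> = (\<Prod>z\<in>A - {p, q}. card B)" by (rule prod.cong) auto
  also have "\<dots> = card B ^ (card A - 2)"
    using assms by (simp add: card_Diff_subset numeral_2_eq_2)
  finally show ?thesis by simp
next
  case False
  then have "{f \<in> A \<rightarrow>\<^sub>E B. f p = a \<and> f q = b} = {}" using assms by auto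
  then show ?thesis by (simp only: card.empty)
qed

text \<open>The factor 2 counts the two ways of sending the pair \<open>s\<close> onto the pair
  \<open>e\<close>.\<close>

lemma card_PiE_image_pair:
  assumes "finite A" "s \<subseteq> A" "card s = 2" "card e = 2" "finite B"
  shows "card {f \<in> A \<rightarrow>\<^sub>E B. f ` s = e} \<le> 2 * card B ^ (card A - 2)"
proof -
  obtain p q where s: "s = {p, q}" "p \<noteq> q" using assms(3) by (auto simp: card_2_iff)
  obtain a b where e: "e = {a, b}" using assms(4) by (auto simp: card_2_iff)
  let ?P = "\<lambda>a b. {f \<in> A \<rightarrow>\<^sub>E B. f p = a \<and> f q = b}"
  have "card {f \<in> A \<rightarrow>\<^sub>E B. f ` s = e} \<le> card (?P a b \<union> ?P b a)"
    using assms(1,5) by (intro card_mono) (auto simp: s e doubleton_eq_iff finite_PiE)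
  also have "\<dots> \<le> card (?P a b) + card (?P b a)" by (rule card_Un_le)
  also have "\<dots> \<le> 2 * card B ^ (card A - 2)"
    using assms(1,2) s card_PiE_two_fixed[of A p q B a b] card_PiE_two_fixed[of A p q B b a] by simp
  finally show ?thesis .
qed

text \<open>An adjacent edge is named by the end it shares with \<open>e\<close> and by its other
  end.\<close>

lemma card_adjacent_edges:
  assumes "e \<in> edges (complete_graph n)"
  shows "card {d \<in> edges (complete_graph n). d \<noteq> e \<and> d \<inter> e \<noteq> {}} \<le> 2 * n"
proof -
  obtain a b where e: "e = {a, b}"
    using assms by (auto simp: complete_graph_def nsets_def card_2_iff)
  have "{d \<in> edges (complete_graph n). d \<noteq> e \<and> d \<inter> e \<noteq> {}} \<subseteq> (\<lambda>(u, w). {u, w}) ` ({a, b} \<times> {..<n})"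
    (is "?L \<subseteq> ?R")
  proof
    fix d assume "d \<in> ?L"
    then obtain x y where "d = {x, y}" "x < n" "y < n" "{x, y} \<inter> {a, b} \<noteq> {}"
      by (auto simp: complete_graph_def nsets_def card_2_iff e)
    then consider "x \<in> {a, b}" | "y \<in> {a, b}" by blast
    then show "d \<in> ?R"
    proof cases
      case 1
      then show ?thesis using \<open>d = {x, y}\<close> \<open>y < n\<close> by force
    next
      case 2
      then show ?thesis using \<open>d = {x, y}\<close> \<open>x < n\<close> by (force simp: insert_commute)
    qed
  qed
  then have "card ?L \<le> card ?R" by (intro card_mono) auto
  also have "\<dots> \<le> card ({a, b} \<times> {..<n})" by (rule card_image_le) auto
  also have "\<dots> = card {a, b} * n" by (simp add: card_cartesian_product)
  also have "\<dots> \<le> 2 * n" by (intro mult_right_mono) (auto simp: card_insert_if)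
  finally show ?thesis .
qed

section \<open>Good colourings of the complete graph\<close>

definition repeat_injections :: "nat \<Rightarrow> 'a ugraph \<Rightarrow> nat \<Rightarrow> (nat \<times> 'a \<Rightarrow> nat) set" where
  "repeat_injections k H n =
     {\<Phi> \<in> {..<k} \<times> verts H \<rightarrow>\<^sub>E {..<n}. inj_on \<Phi> ({..<k} \<times> verts H)}"

definition monochrome_layers :: "nat \<Rightarrow> 'a ugraph \<Rightarrow> (nat \<times> 'a \<Rightarrow> nat) \<Rightarrow> (nat set \<Rightarrow> nat) \<Rightarrow> bool" where
  "monochrome_layers k H \<Phi> c \<longleftrightarrow>
     (\<forall>i<k. \<forall>j<k. \<forall>d\<in>edges H. c (\<Phi> ` ({i} \<times> d)) = c (\<Phi> ` ({j} \<times> d)))"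

text \<open>Stating repeats through injections and relative to \<open>F\<close> gives a condition
  that passes to smaller edge sets, as the locale demands.\<close>

definition good_on :: "nat \<Rightarrow> 'a ugraph \<Rightarrow> nat \<Rightarrow> nat set set \<Rightarrow> (nat set \<Rightarrow> nat) \<Rightarrow> bool" where
  "good_on k H n F c \<longleftrightarrow>
     (\<forall>d\<in>F. \<forall>e\<in>F. d \<noteq> e \<and> d \<inter> e \<noteq> {} \<longrightarrow> c d \<noteq> c e) \<and>
     (\<nexists>\<Phi>. \<Phi> \<in> repeat_injections k H n \<and> (\<forall>i<k. \<forall>d\<in>edges H. \<Phi> ` ({i} \<times> d) \<in> F) \<and>
       monochrome_layers k H \<Phi> c)"

text \<open>The order in the pair matters: the colour of the first edge is the one forced, by that
  of the second.\<close>

definition adjacency_obstructions :: "nat \<Rightarrow> nat set \<Rightarrow> (nat set \<times> nat set) set" where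
  "adjacency_obstructions n e = {e} \<times> {d \<in> edges (complete_graph n). d \<noteq> e \<and> d \<inter> e \<noteq> {}}"

text \<open>In \<open>(j, \<Phi>)\<close> the layer \<open>j\<close> avoids \<open>e\<close>; its colours determine those of the other layers.\<close>

definition repeat_obstructions ::
    "nat \<Rightarrow> 'a ugraph \<Rightarrow> nat \<Rightarrow> nat set \<Rightarrow> (nat \<times> (nat \<times> 'a \<Rightarrow> nat)) set" where
  "repeat_obstructions k H n e = {(j, \<Phi>). j < k \<and> \<Phi> \<in> repeat_injections k H n \<and>
     (\<exists>i<k. i \<noteq> j \<and> (\<exists>d\<in>edges H. \<Phi> ` ({i} \<times> d) = e))}"

text \<open>This serves as \<open>T\<close> for repeat obstructions. It contains \<open>e\<close>,
  which by definition of the obstruction is an edge of some layer other than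
  \<open>j\<close>.\<close>

definition other_layers :: "nat \<Rightarrow> 'a ugraph \<Rightarrow> nat \<times> (nat \<times> 'a \<Rightarrow> nat) \<Rightarrow> nat set set" where
  "other_layers k H = (\<lambda>(j, \<Phi>). (\<lambda>(i, d). \<Phi> ` ({i} \<times> d)) ` (({..<k} - {j}) \<times> edges H))"

lemma simple_graph_edge:
  assumes "simple_graph H" "d \<in> edges H"
  shows "d \<subseteq> verts H" "card d = 2" "d \<noteq> {}"
  using assms by (auto simp: simple_graph_def nsets_def)

text \<open>Injectivity reduces the equality to one of products \<open>{i} \<times> d\<close>, and
  edges are nonempty, so the layer index can be read off.\<close>

lemma layer_eq_iff:
  assumes "simple_graph H" "\<Phi> \<in> repeat_injections k H n"
    "i < k" "j < k" "d \<in> edges H" "d' \<in> edges H"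
  shows "\<Phi> ` ({i} \<times> d) = \<Phi> ` ({j} \<times> d') \<longleftrightarrow> i = j \<and> d = d'"
proof -
  have "\<Phi> ` ({i} \<times> d) = \<Phi> ` ({j} \<times> d') \<longleftrightarrow> {i} \<times> d = {j} \<times> d'"
    by (rule inj_on_image_eq_iff[where C = "{..<k} \<times> verts H"])
      (use assms simple_graph_edge(1)[OF assms(1)] in \<open>auto simp: repeat_injections_def\<close>)
  then show ?thesis using simple_graph_edge(3)[OF assms(1)] assms by (auto simp: times_eq_iff)
qed

lemma card_other_layers:
  assumes "simple_graph H" "(j, \<Phi>) \<in> repeat_obstructions k H n e"
  shows "card (other_layers k H (j, \<Phi>)) = (k - 1) * card (edges H)"
proof -
  have "\<Phi> \<in> repeat_injections k H n" "j < k"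
    using assms by (auto simp: repeat_obstructions_def)
  then have "inj_on (\<lambda>(i, d). \<Phi> ` ({i} \<times> d)) (({..<k} - {j}) \<times> edges H)"
    using layer_eq_iff[OF assms(1)] by (auto simp: inj_on_def)
  from card_image[OF this] \<open>j < k\<close> show ?thesis
    by (simp add: other_layers_def card_cartesian_product)
qed

text \<open>Injectivity and the condition \<open>i \<noteq> j\<close> are dropped, leaving the sets
  counted by \<open>card_PiE_image_pair\<close>.\<close>

lemma repeat_obstructions_subset:
  "repeat_obstructions k H n e \<subseteq> {..<k} \<times>
    (\<Union>(i, d)\<in>{..<k} \<times> edges H. {\<Phi> \<in> {..<k} \<times> verts H \<rightarrow>\<^sub>E {..<n}. \<Phi> ` ({i} \<times> d) = e})"
  by (fastforce simp: repeat_obstructions_def repeat_injections_def)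

lemma finite_edges: "simple_graph H \<Longrightarrow> finite (edges H)"
  using finite_imp_finite_nsets finite_subset unfolding simple_graph_def by blast

lemma finite_repeat_obstructions:
  assumes "simple_graph H"
  shows "finite (repeat_obstructions k H n e)"
  by (rule finite_subset[OF repeat_obstructions_subset])
    (use assms finite_edges[OF assms] in \<open>auto simp: simple_graph_def finite_PiE\<close>)

text \<open>One factor \<open>k\<close> is for \<open>j\<close>, the other with
  \<open>card (edges H)\<close> for the layer edge mapped to \<open>e\<close>, and 2 for its
  orientation. Fixing the two ends leaves \<open>k * card (verts H) - 2\<close> free
  vertices.\<close>

lemma card_repeat_obstructions:
  assumes "simple_graph H" "card e = 2"
  shows "card (repeat_obstructions k H n e) \<le>
    2 * k\<^sup>2 * card (edges H) * n ^ (k * card (verts H) - 2)"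
proof -
  let ?A = "{..<k} \<times> verts H" and ?J = "{..<k} \<times> edges H"
  let ?U = "\<lambda>(i, d). {\<Phi> \<in> ?A \<rightarrow>\<^sub>E {..<n}. \<Phi> ` ({i} \<times> d) = e}"
  have finA: "finite ?A" using assms by (simp add: simple_graph_def)
  have finJ: "finite ?J" using finite_edges[OF assms(1)] by simp
  have "card (?U p) \<le> 2 * n ^ (k * card (verts H) - 2)" if "p \<in> ?J" for p
  proof -
    obtain i d where p: "p = (i, d)" "i < k" "d \<in> edges H"
      using \<open>p \<in> ?J\<close> by auto
    then show ?thesis
      using card_PiE_image_pair[OF finA, of "{i} \<times> d" e "{..<n}"] assms
        simple_graph_edge[OF assms(1), of d]
      by (auto simp: card_cartesian_product)
  qed
  then have "(\<Sum>p\<in>?J. card (?U p)) \<le> card ?J * (2 * n ^ (k * card (verts H) - 2))"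
    using sum_bounded_above[of ?J "\<lambda>p. card (?U p)"] by simp
  then have union: "card (\<Union>p\<in>?J. ?U p) \<le> card ?J * (2 * n ^ (k * card (verts H) - 2))"
    using card_UN_le[OF finJ, of ?U] by linarith
  have "card (repeat_obstructions k H n e) \<le> card ({..<k} \<times> (\<Union>p\<in>?J. ?U p))"
    by (rule card_mono[OF _ repeat_obstructions_subset]) (use finA finJ in \<open>auto simp: finite_PiE\<close>)
  also have "\<dots> = k * card (\<Union>p\<in>?J. ?U p)"
    by (simp only: card_cartesian_product card_lessThan)
  also have "\<dots> \<le> k * (card ?J * (2 * n ^ (k * card (verts H) - 2)))"
    using union by (rule mult_le_mono2)
  finally have "card (repeat_obstructions k H n e) \<le>
      k * (card ?J * (2 * n ^ (k * card (verts H) - 2)))" .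
  then show ?thesis by (simp add: card_cartesian_product power2_eq_square mult_ac)
qed

section \<open>Verifying the conditions of the counting argument\<close>

lemma good_on_mono:
  assumes "good_on k H n F c" "F' \<subseteq> F" "\<And>x. x \<in> F' \<Longrightarrow> c x = c' x"
  shows "good_on k H n F' c'"
  unfolding good_on_def
proof (intro conjI notI)
  show "\<forall>d\<in>F'. \<forall>e\<in>F'. d \<noteq> e \<and> d \<inter> e \<noteq> {} \<longrightarrow> c' d \<noteq> c' e"
    using assms unfolding good_on_def by (metis subsetD)
  assume "\<exists>\<Phi>. \<Phi> \<in> repeat_injections k H n \<and> (\<forall>i<k. \<forall>d\<in>edges H. \<Phi> ` ({i} \<times> d) \<in> F') \<and>
    monochrome_layers k H \<Phi> c'"
  then obtain \<Phi> where \<Phi>: "\<Phi> \<in> repeat_injections k H n"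
    "\<forall>i<k. \<forall>d\<in>edges H. \<Phi> ` ({i} \<times> d) \<in> F'" "monochrome_layers k H \<Phi> c'" by blast
  have "monochrome_layers k H \<Phi> c"
    using \<Phi>(2,3) assms(3) unfolding monochrome_layers_def by metis
  moreover have "\<forall>i<k. \<forall>d\<in>edges H. \<Phi> ` ({i} \<times> d) \<in> F" using \<Phi>(2) assms(2) by auto
  ultimately show False using \<Phi>(1) assms(1) unfolding good_on_def by metis
qed

text \<open>As \<open>F\<close> is good, any violation on \<open>insert e F\<close> must use
  \<open>e\<close>, either in a clash of adjacent edges or as an edge of some layer.\<close>

lemma good_on_obstruction:
  assumes k: "k \<ge> 2" and F: "F \<subseteq> edges (complete_graph n)" and e: "e \<in> edges (complete_graph n) - F"
    and good: "good_on k H n F c" and not_good: "\<not> good_on k H n (insert e F) c"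
  shows "(\<exists>d. (e, d) \<in> adjacency_obstructions n e \<and> c e = c d) \<or>
    (\<exists>p\<in>repeat_obstructions k H n e. other_layers k H p \<subseteq> insert e F \<and> monochrome_layers k H (snd p) c)"
proof (cases "\<forall>d\<in>insert e F. \<forall>d'\<in>insert e F. d \<noteq> d' \<and> d \<inter> d' \<noteq> {} \<longrightarrow> c d \<noteq> c d'")
  case False
  then obtain d d' where d: "d \<in> insert e F" "d' \<in> insert e F" "d \<noteq> d'" "d \<inter> d' \<noteq> {}" "c d = c d'"
    by blast
  then have "d = e \<or> d' = e" using good unfolding good_on_def by blast
  then obtain d'' where "d'' \<in> F" "d'' \<inter> e \<noteq> {}" "c e = c d''"
    using d by (metis Int_commute insertE)
  then show ?thesis using e F by (auto simp: adjacency_obstructions_def)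
next
  case True
  then obtain \<Phi> where \<Phi>: "\<Phi> \<in> repeat_injections k H n" "monochrome_layers k H \<Phi> c"
    "\<forall>i<k. \<forall>d\<in>edges H. \<Phi> ` ({i} \<times> d) \<in> insert e F"
    using not_good unfolding good_on_def by metis
  then have "\<not> (\<forall>i<k. \<forall>d\<in>edges H. \<Phi> ` ({i} \<times> d) \<in> F)"
    using good unfolding good_on_def by metis
  then obtain i d where i: "i < k" "d \<in> edges H" "\<Phi> ` ({i} \<times> d) = e"
    using \<Phi>(3) by (metis insertE)
  \<comment> \<open>Any layer other than \<open>i\<close> would do; one exists because
    \<open>k \<ge> 2\<close>.\<close>
  define j where "j = (if i = 0 then 1 else 0 :: nat)"
  have "j < k" "i \<noteq> j" using k by (auto simp: j_def)
  then have "(j, \<Phi>) \<in> repeat_obstructions k H n e"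
    using \<Phi> i by (auto simp: repeat_obstructions_def)
  moreover have "other_layers k H (j, \<Phi>) \<subseteq> insert e F"
    using \<Phi>(3) by (auto simp: other_layers_def)
  ultimately show ?thesis using \<Phi>(2) by (metis snd_conv)
qed

text \<open>Layer \<open>j\<close> is disjoint from \<open>other_layers\<close>, so both colourings
  agree on it, and each of the other layers copies its colours.\<close>

lemma monochrome_layers_determined:
  assumes H: "simple_graph H" and j: "(j, \<Phi>) \<in> repeat_obstructions k H n e"
    and mono: "monochrome_layers k H \<Phi> c" "monochrome_layers k H \<Phi> c'"
    and eq: "\<And>x. x \<notin> other_layers k H (j, \<Phi>) \<Longrightarrow> c x = c' x"
  shows "c = c'"
proof
  fix x
  have \<Phi>: "\<Phi> \<in> repeat_injections k H n" "j < k"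
    using j by (auto simp: repeat_obstructions_def)
  show "c x = c' x"
  proof (cases "x \<in> other_layers k H (j, \<Phi>)")
    case True
    then obtain i d where x: "i < k" "d \<in> edges H" "x = \<Phi> ` ({i} \<times> d)"
      by (auto simp: other_layers_def)
    have "\<Phi> ` ({j} \<times> d) \<notin> other_layers k H (j, \<Phi>)"
      using layer_eq_iff[OF H \<Phi>(1)] \<Phi>(2) x(2) by (fastforce simp: other_layers_def)
    then have "c (\<Phi> ` ({j} \<times> d)) = c' (\<Phi> ` ({j} \<times> d))" by (rule eq)
    then show ?thesis using mono x \<Phi>(2) by (metis monochrome_layers_def)
  qed (rule eq)
qed

text \<open>With \<beta> = C/2, the obstructions may weigh C/2 in total. \<open>C1\<close> grants
  C/4 to the at most 2n adjacent edges, of weight 1 each, and \<open>C2\<close> grants C/4 to the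
  repeats, of weight (2/C)^(m-1) each.\<close>

lemma repeat_free_colouring_exists:
  fixes H :: "'a ugraph"
  assumes H: "simple_graph H" and k: "k \<ge> 2" and edges: "edges H \<noteq> {}" and n: "n \<ge> 1"
    and C1: "8 * n \<le> C"
    and C2: "2 * k\<^sup>2 * card (edges H) * n ^ (k * card (verts H) - 2) * 2 ^ ((k - 1) * card (edges H) + 1)
      \<le> C ^ ((k - 1) * card (edges H))"
  shows "\<exists>c. repeat_free_colouring k n H C c"
proof -
  let ?E = "edges (complete_graph n)"
  define I where "I e = adjacency_obstructions n e <+> repeat_obstructions k H n e" for e
  define T where "T = case_sum (\<lambda>(e, d :: nat set). {e}) (other_layers k H)"
  define bad where "bad i c = (case i of Inl (e, d) \<Rightarrow> c e = c d | Inr p \<Rightarrow> monochrome_layers k H (snd p) c)"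
    for i :: "nat set \<times> nat set + nat \<times> (nat \<times> 'a \<Rightarrow> nat)" and c :: "nat set \<Rightarrow> nat"
  define m where "m = (k - 1) * card (edges H)"
  have m: "m \<ge> 1" using k edges finite_edges[OF H] by (simp add: m_def Suc_le_eq card_gt_0_iff)
  have C_pos: "C > 0" using C1 n by simp
  have finE: "finite ?E" by (simp add: complete_graph_def finite_imp_finite_nsets)
  have fin_adj: "finite (adjacency_obstructions n e)" for e
    using finE by (simp add: adjacency_obstructions_def)
  interpret obstructed_colouring ?E "good_on k H n" C I T bad "real C / 2"
  proof
    show "finite ?E" by (rule finE)
    show "finite (I e)" for e
      using fin_adj finite_repeat_obstructions[OF H] by (simp add: I_def)
    \<comment> \<open>Layer 0 exists and has an edge, which cannot lie in the empty set, so no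
      repeat is present vacuously.\<close>
    show "good_on k H n {} c" for c
      using edges k by (auto simp: good_on_def intro!: exI[of _ 0])
    show "good_on k H n F' c'" if "good_on k H n F c" "F' \<subseteq> F" "\<And>x. x \<in> F' \<Longrightarrow> c x = c' x" for F F' c c'
      using that by (rule good_on_mono)
    show "\<exists>i\<in>I e. T i \<subseteq> insert e F \<and> bad i c"
      if "F \<subseteq> ?E" "e \<in> ?E - F" "good_on k H n F c" "\<not> good_on k H n (insert e F) c" for F e c
      using good_on_obstruction[OF k that]
    proof (elim disjE exE bexE conjE)
      fix d assume "(e, d) \<in> adjacency_obstructions n e" "c e = c d"
      then show ?thesis by (intro bexI[of _ "Inl (e, d)"]) (auto simp: I_def T_def bad_def)
    next
      fix p assume "p \<in> repeat_obstructions k H n e" "other_layers k H p \<subseteq> insert e F"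
        "monochrome_layers k H (snd p) c"
      then show ?thesis by (intro bexI[of _ "Inr p"]) (auto simp: I_def T_def bad_def)
    qed
    show "e \<in> T i" if "i \<in> I e" for e i
      using that
      by (fastforce simp: I_def T_def adjacency_obstructions_def repeat_obstructions_def other_layers_def)
    show "c = c'" if "i \<in> I e" "bad i c" "bad i c'" "\<And>x. x \<notin> T i \<Longrightarrow> c x = c' x" for e i c c'
    proof (cases i)
      case (Inl q)
      then obtain d where q: "i = Inl (e, d)" "d \<noteq> e"
        using \<open>i \<in> I e\<close> by (auto simp: I_def adjacency_obstructions_def)
      \<comment> \<open>In particular the colourings agree at \<open>d\<close>, since
        \<open>d \<noteq> e\<close>, and \<open>bad\<close> carries that colour over to
        \<open>e\<close>.\<close>
      then have "c x = c' x" if "x \<noteq> e" for x using \<open>\<And>x. x \<notin> T i \<Longrightarrow> c x = c' x\<close> that by (simp add: T_def)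
      moreover from this have "c e = c' e" using that(2,3) q by (simp add: bad_def)
      ultimately show ?thesis by (intro ext) metis
    next
      case (Inr p)
      then obtain j \<Phi> where p: "i = Inr (j, \<Phi>)" "(j, \<Phi>) \<in> repeat_obstructions k H n e"
        using \<open>i \<in> I e\<close> by (cases p) (auto simp: I_def)
      then show ?thesis
        using monochrome_layers_determined[OF H p(2), of c c'] that(2-4) by (simp add: bad_def T_def)
    qed
    show "real C / 2 > 0" using C_pos by simp
    show "real C / 2 + (\<Sum>i\<in>I e. (1 / (real C / 2)) ^ (card (T i) - 1)) \<le> real C" if e: "e \<in> ?E" for e
    proof -
      let ?w = "\<lambda>i. (1 / (real C / 2)) ^ (card (T i) - 1)"
      have "(\<Sum>q\<in>adjacency_obstructions n e. ?w (Inl q)) = real (card (adjacency_obstructions n e))"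
        by (simp add: T_def case_prod_unfold)
      also have "\<dots> \<le> 2 * real n"
        using card_adjacent_edges[OF e]
        by (simp add: adjacency_obstructions_def card_cartesian_product)
      also have "\<dots> \<le> real C / 4" using C1 by simp
      finally have adj: "(\<Sum>q\<in>adjacency_obstructions n e. ?w (Inl q)) \<le> real C / 4" .
      have card_e: "card e = 2" using e by (auto simp: complete_graph_def nsets_def)
      have "?w (Inr p) = (2 / real C) ^ (m - 1)" if "p \<in> repeat_obstructions k H n e" for p
        using card_other_layers[OF H, of "fst p" "snd p"] that by (simp add: T_def m_def)
      then have "(\<Sum>p\<in>repeat_obstructions k H n e. ?w (Inr p)) =
          real (card (repeat_obstructions k H n e)) * (2 / real C) ^ (m - 1)"
        by simp
      also have "\<dots> \<le> real (2 * k\<^sup>2 * card (edges H) * n ^ (k * card (verts H) - 2)) * (2 / real C) ^ (m - 1)"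
        using card_repeat_obstructions[OF H card_e] by (intro mult_right_mono) (auto simp only: of_nat_le_iff, simp)
      also have "\<dots> \<le> real C / 4"
      \<comment> \<open>Cleared of denominators this is \<open>C2\<close>: the 2^(m-1) of the weight
        and the 4 of the quarter combine to 2^(m+1).\<close>
      proof -
        obtain l where l: "m = Suc l" using m by (cases m) auto
        have "real (2 * k\<^sup>2 * card (edges H) * n ^ (k * card (verts H) - 2)) * 2 ^ (m + 1) \<le> real C ^ m"
          using of_nat_mono[OF C2, where ?'a = real] by (simp add: m_def)
        then show ?thesis using C_pos by (simp add: l power_divide field_simps)
      qed
      finally have "(\<Sum>p\<in>repeat_obstructions k H n e. ?w (Inr p)) \<le> real C / 4" .
      moreover have "sum ?w (I e) =
          (\<Sum>q\<in>adjacency_obstructions n e. ?w (Inl q)) + (\<Sum>p\<in>repeat_obstructions k H n e. ?w (Inr p))"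
        unfolding I_def using fin_adj finite_repeat_obstructions[OF H] by (simp add: sum.Plus)
      ultimately show ?thesis using adj by simp
    qed
  qed
  obtain c where c: "c \<in> ?E \<rightarrow>\<^sub>E {..<C}" "good_on k H n ?E c"
    using good_colouring_exists by blast
  have "\<not> is_repeat k H (complete_graph n) c R" for R
  proof
    assume R: "is_repeat k H (complete_graph n) c R"
    have "k \<ge> 1" using k by simp
    from is_repeat_injection[OF H this R] obtain \<Phi>
      where \<Phi>: "\<Phi> \<in> {..<k} \<times> verts H \<rightarrow>\<^sub>E verts (complete_graph n)" "inj_on \<Phi> ({..<k} \<times> verts H)"
      and layers: "\<And>i d. i < k \<Longrightarrow> d \<in> edges H \<Longrightarrow> \<Phi> ` ({i} \<times> d) \<in> ?E"
      and colours: "\<And>i j d. i < k \<Longrightarrow> j < k \<Longrightarrow> d \<in> edges H \<Longrightarrow>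
        c (\<Phi> ` ({i} \<times> d)) = c (\<Phi> ` ({j} \<times> d))"
      by metis
    have "\<Phi> \<in> repeat_injections k H n"
      using \<Phi> by (simp add: repeat_injections_def complete_graph_def)
    moreover have "monochrome_layers k H \<Phi> c"
      unfolding monochrome_layers_def using colours by blast
    moreover have "\<forall>i<k. \<forall>d\<in>edges H. \<Phi> ` ({i} \<times> d) \<in> ?E" using layers by blast
    ultimately show False using c(2) unfolding good_on_def by metis
  qed
  moreover have "proper_colouring (complete_graph n) c"
    using c(2) unfolding good_on_def proper_colouring_def by blast
  ultimately show ?thesis using c(1) by (auto simp: repeat_free_colouring_def)
qed

section \<open>Choice of the number of colours and the asymptotic bound\<close>

theorem theorem2p5:
  fixes H :: "'a ugraph" and v e k :: nat
  assumes "simple_graph H"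
    and "card (verts H) = v"
    and "card (edges H) = e"
    and "e \<ge> 1"
    and "k \<ge> 2"
  shows "(\<lambda>n. real (repeat_num k n H)) \<in>
    O(\<lambda>n. max (real n) (real n powr ((real k * real v - 2) / ((real k - 1) * real e))))"
proof -
  define m where "m = (k - 1) * e"
  \<comment> \<open>The summand 8 yields \<open>C1\<close>; the other is the constant of
    \<open>C2\<close>, which is at most \<open>K\<close> and hence at most
    \<open>K ^ m\<close>.\<close>
  define K where "K = 8 + 2 * k\<^sup>2 * e * 2 ^ (m + 1)"
  let ?g = "\<lambda>n. max (real n) (real n powr ((real k * real v - 2) / ((real k - 1) * real e)))"
  have edges: "edges H \<noteq> {}" using assms(3,4) by auto
  have m: "m \<ge> 1" "real m = (real k - 1) * real e"
    using assms(4,5) by (auto simp: m_def Suc_le_eq)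
  have "v \<ge> 2"
  proof -
    obtain d where "d \<in> edges H" using edges by blast
    then show ?thesis
      using simple_graph_edge[OF assms(1)] card_mono[of "verts H" d] assms(1,2)
      by (auto simp: simple_graph_def)
  qed
  \<comment> \<open>An edge forces \<open>v \<ge> 2\<close>, so the subtraction on naturals is not
    truncated.\<close>
  then have kv: "real (k * v - 2) = real k * real v - 2"
    using assms(5) mult_le_mono[of 2 k 1 v] by (simp add: of_nat_diff)
  have bound: "real (repeat_num k n H) \<le> (K + 1) * ?g n" if n: "n \<ge> 1" for n
  proof -
    define C where "C = nat \<lceil>K * ?g n\<rceil>"
    have C: "real K * ?g n \<le> real C" by (simp add: C_def real_nat_ceiling_ge)
    have "real (8 * n) \<le> real K * ?g n"
      unfolding of_nat_mult by (rule mult_mono) (auto simp: K_def)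
    then have C1: "8 * n \<le> C" using C by linarith
    \<comment> \<open>The exponent in the theorem is \<open>(k * v - 2) / m\<close>, chosen so that
      its \<open>m\<close>-th power matches the number of repeats.\<close>
    have "real n ^ (k * v - 2) = (real n powr ((real k * real v - 2) / ((real k - 1) * real e))) ^ m"
      using n m by (simp add: powr_realpow[symmetric] powr_powr kv flip: m(2))
    also have "\<dots> \<le> ?g n ^ m" by (intro power_mono) auto
    finally have "real n ^ (k * v - 2) \<le> ?g n ^ m" .
    moreover have "real (2 * k\<^sup>2 * e * 2 ^ (m + 1)) \<le> real K ^ m"
    proof -
      have "real (2 * k\<^sup>2 * e * 2 ^ (m + 1)) \<le> real K" unfolding K_def by linarith
      also have "\<dots> \<le> real K ^ m" using m(1) by (intro self_le_power) (auto simp: K_def)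
      finally show ?thesis .
    qed
    ultimately have "real (2 * k\<^sup>2 * e * 2 ^ (m + 1)) * real n ^ (k * v - 2) \<le> real K ^ m * ?g n ^ m"
      by (intro mult_mono) auto
    also have "\<dots> = (real K * ?g n) ^ m" by (rule power_mult_distrib[symmetric])
    also have "\<dots> \<le> real C ^ m" using C by (intro power_mono) (auto simp: max_def)
    finally have "real (2 * k\<^sup>2 * e * n ^ (k * v - 2) * 2 ^ (m + 1)) \<le> real (C ^ m)"
      by (simp add: mult_ac)
    then have C2: "2 * k\<^sup>2 * e * n ^ (k * v - 2) * 2 ^ (m + 1) \<le> C ^ m"
      by (simp only: of_nat_le_iff)
    have "\<exists>c. repeat_free_colouring k n H C c"
      by (rule repeat_free_colouring_exists[OF assms(1,5) edges n C1])
        (use C2 in \<open>simp add: assms(2,3) m_def\<close>)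
    then have "repeat_num k n H \<le> C" unfolding repeat_num_def by (rule Least_le)
    also have "real C \<le> K * ?g n + 1"
    proof -
      have "0 \<le> K * ?g n" by (simp add: max_def)
      then have "real C = of_int \<lceil>K * ?g n\<rceil>" unfolding C_def by (intro of_nat_nat) linarith
      then show ?thesis using of_int_ceiling_le_add_one[of "K * ?g n"] by linarith
    qed
    \<comment> \<open>The 1 lost to rounding up is absorbed because
      \<open>?g n \<ge> n \<ge> 1\<close>.\<close>
    also have "\<dots> \<le> (K + 1) * ?g n"
      using n by (auto simp: algebra_simps max_def)
    finally show ?thesis by simp
  qed
  show ?thesis
  proof (rule bigoI)
    show "\<forall>\<^sub>F n in at_top. norm (real (repeat_num k n H)) \<le> (K + 1) * norm (?g n)"
      using eventually_ge_at_top[of 1] by eventually_elim (use bound in \<open>auto simp: max_def\<close>)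
  qed
qed

end
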